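(* Let $\rho>0$ and $y_0\in\mathbb R$, and set $\hat e(y,t)=e^{-\sqrt3\rho\left(y+\frac{t}{\rho^2}+y_0\right)}$, $$x(y,t)=y+\frac{2\sqrt3}{\rho}\,\frac{\hat e}{1+\hat e},\qquad \hat u(y,t)=-\frac6{\rho^2}\,\frac{\hat e}{(1+\hat e)^2},\qquad \hat q(y,t)=\frac{1+2\hat e+\hat e^2}{1-4\hat e+\hat e^2}.$$ Then $u(x,t)=\hat u(y(x,t),t)$ and $q(x,t)=\hat q(y(x,t),t)$, where $y(x,t)$ is any smooth local branch of the inverse of $y\mapsto x(y,t)$ (defined where $1-4\hat e+\hat e^2\ne0$), satisfy the equation $u_{txx}-3u_x+3u_xu_{xx}+uu_{xxx}=0$ in the form of the system $$q_t=-(uq)_x,\qquad u_{xx}=1-q^3.$$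
   Context: This is the parametric form of the one-loop soliton. For fixed $t$ the map $y\mapsto x(y,t)$ is not monotone, so $u(x,t)$ is in general a multivalued (loop-shaped) function of $x$; the equations are understood on each smooth branch. *)

theory Defs
  imports "HOL-Analysis.Analysis"
begin

(* Functions of (x,t) are curried; subsets of the (x,t)-plane are sets of pairs. *)

definition dx :: "(real \<Rightarrow> real \<Rightarrow> real) \<Rightarrow> real \<Rightarrow> real \<Rightarrow> real" where
  "dx f = (\<lambda>x t. deriv (\<lambda>\<xi>. f \<xi> t) x)"

definition dt :: "(real \<Rightarrow> real \<Rightarrow> real) \<Rightarrow> real \<Rightarrow> real \<Rightarrow> real" where
  "dt f = (\<lambda>x t. deriv (\<lambda>\<tau>. f x \<tau>) t)"

(* Meant for open \<Omega>: the partial derivatives at a point of \<Omega> then depend only on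
   the values of f on \<Omega>. *)
primrec Ck_on :: "nat \<Rightarrow> (real \<times> real) set \<Rightarrow> (real \<Rightarrow> real \<Rightarrow> real) \<Rightarrow> bool" where
  "Ck_on 0 \<Omega> f \<longleftrightarrow> continuous_on \<Omega> (\<lambda>(x, t). f x t)"
| "Ck_on (Suc k) \<Omega> f \<longleftrightarrow>
     continuous_on \<Omega> (\<lambda>(x, t). f x t) \<and>
     (\<forall>(x, t) \<in> \<Omega>. (\<lambda>\<xi>. f \<xi> t) differentiable (at x) \<and> (\<lambda>\<tau>. f x \<tau>) differentiable (at t)) \<and>
     Ck_on k \<Omega> (dx f) \<and> Ck_on k \<Omega> (dt f)"

definition smooth_on :: "(real \<times> real) set \<Rightarrow> (real \<Rightarrow> real \<Rightarrow> real) \<Rightarrow> bool" where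
  "smooth_on \<Omega> f \<longleftrightarrow> (\<forall>k. Ck_on k \<Omega> f)"

definition e_hat :: "real \<Rightarrow> real \<Rightarrow> real \<Rightarrow> real \<Rightarrow> real" where
  "e_hat \<rho> y0 y t = exp (- sqrt 3 * \<rho> * (y + t / \<rho>^2 + y0))"

definition x_map :: "real \<Rightarrow> real \<Rightarrow> real \<Rightarrow> real \<Rightarrow> real" where
  "x_map \<rho> y0 y t = y + 2 * sqrt 3 / \<rho> * (e_hat \<rho> y0 y t / (1 + e_hat \<rho> y0 y t))"

definition u_hat :: "real \<Rightarrow> real \<Rightarrow> real \<Rightarrow> real \<Rightarrow> real" where
  "u_hat \<rho> y0 y t = - (6 / \<rho>^2) * (e_hat \<rho> y0 y t / (1 + e_hat \<rho> y0 y t)^2)"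

definition q_hat :: "real \<Rightarrow> real \<Rightarrow> real \<Rightarrow> real \<Rightarrow> real" where
  "q_hat \<rho> y0 y t =
     (1 + 2 * e_hat \<rho> y0 y t + (e_hat \<rho> y0 y t)^2) / (1 - 4 * e_hat \<rho> y0 y t + (e_hat \<rho> y0 y t)^2)"

(* A right inverse Y of the map y \<mapsto> x(y,t) is automatically a two-sided inverse between
   the slice {x. (x,t) \<in> \<Omega>} and its image under Y. *)
definition smooth_inverse_branch ::
    "real \<Rightarrow> real \<Rightarrow> (real \<times> real) set \<Rightarrow> (real \<Rightarrow> real \<Rightarrow> real) \<Rightarrow> bool" where
  "smooth_inverse_branch \<rho> y0 \<Omega> Y \<longleftrightarrow>
     open \<Omega> \<and> smooth_on \<Omega> Y \<and>
     (\<forall>(x, t) \<in> \<Omega>. x_map \<rho> y0 (Y x t) t = x \<and>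
        1 - 4 * e_hat \<rho> y0 (Y x t) t + (e_hat \<rho> y0 (Y x t) t)^2 \<noteq> 0)"

end

(*
  Differentiating x(Y(x,t),t) = x gives Y_x = q and Y_t = -u q. Since u q = (1 - q) / rho^2, the
  quantity E(x,t) = e_hat(Y(x,t),t) satisfies E_t = E_x / rho^2: the loop soliton is a travelling
  wave, so on Omega every t-derivative of a function of E is 1/rho^2 times its x-derivative.
  With w = u_x, the x-derivatives close up polynomially,
    u_x = w,   q_x = -rho^2 w q^2,   w_x = 1 - q^3,
  which gives smoothness by bootstrapping, and reduces the equations to rho^2 u q = 1 - q.
*)

theory Submission
  imports Defs
begin

section \<open>Partial derivatives and C^k calculus on open subsets of the plane\<close>

text \<open>A relational form of \<open>dx\<close> and \<open>dt\<close>: \<open>deriv\<close> also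
  returns a value where no derivative exists, so existence and explicit formulas for both partials
  are recorded together.\<close>

definition has_partials ::
    "(real \<times> real) set \<Rightarrow> (real \<Rightarrow> real \<Rightarrow> real) \<Rightarrow> (real \<Rightarrow> real \<Rightarrow> real) \<Rightarrow> (real \<Rightarrow> real \<Rightarrow> real) \<Rightarrow> bool"
  where "has_partials \<Omega> f fx ft \<longleftrightarrow> (\<forall>x t. (x, t) \<in> \<Omega> \<longrightarrow>
    ((\<lambda>\<xi>. f \<xi> t) has_real_derivative fx x t) (at x) \<and>
    ((\<lambda>\<tau>. f x \<tau>) has_real_derivative ft x t) (at t))"

lemma has_partialsD:
  assumes "has_partials \<Omega> f fx ft" "(x, t) \<in> \<Omega>"
  shows "((\<lambda>\<xi>. f \<xi> t) has_real_derivative fx x t) (at x)"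
    and "((\<lambda>\<tau>. f x \<tau>) has_real_derivative ft x t) (at t)"
    and "dx f x t = fx x t" and "dt f x t = ft x t"
  using assms by (auto simp: has_partials_def dx_def dt_def intro!: DERIV_imp_deriv)

lemma has_partials_imp_differentiable:
  assumes "has_partials \<Omega> f fx ft"
  shows "\<forall>(x, t) \<in> \<Omega>. (\<lambda>\<xi>. f \<xi> t) differentiable (at x) \<and> (\<lambda>\<tau>. f x \<tau>) differentiable (at t)"
  using has_partialsD(1,2)[OF assms] unfolding real_differentiable_def by blast

lemma eventually_slices:
  assumes "open \<Omega>" "(x, t) \<in> \<Omega>"
  shows "\<forall>\<^sub>F \<xi> in nhds x. (\<xi>, t) \<in> \<Omega>" "\<forall>\<^sub>F \<tau> in nhds t. (x, \<tau>) \<in> \<Omega>"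
proof -
  obtain A B where AB: "open A" "open B" "x \<in> A" "t \<in> B" and sub: "A \<times> B \<subseteq> \<Omega>"
    by (rule open_prod_elim[OF assms]) auto
  show "\<forall>\<^sub>F \<xi> in nhds x. (\<xi>, t) \<in> \<Omega>"
    using eventually_nhds_in_open[OF AB(1,3)] by (rule eventually_mono) (use AB(4) sub in blast)
  show "\<forall>\<^sub>F \<tau> in nhds t. (x, \<tau>) \<in> \<Omega>"
    using eventually_nhds_in_open[OF AB(2,4)] by (rule eventually_mono) (use AB(3) sub in blast)
qed

text \<open>Partials at a point depend only on nearby values along the two slices, and openness
  keeps these in Omega. Formulas valid merely on Omega can therefore be differentiated, which
  matters because \<open>u\<close> and \<open>q\<close> are prescribed only there.\<close>

lemma has_partials_cong:
  assumes "open \<Omega>" "has_partials \<Omega> f fx ft"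
    and "\<And>x t. (x, t) \<in> \<Omega> \<Longrightarrow> g x t = f x t"
    and "\<And>x t. (x, t) \<in> \<Omega> \<Longrightarrow> gx x t = fx x t"
    and "\<And>x t. (x, t) \<in> \<Omega> \<Longrightarrow> gt x t = ft x t"
  shows "has_partials \<Omega> g gx gt"
  unfolding has_partials_def
proof (intro allI impI conjI)
  fix x t assume xt: "(x, t) \<in> \<Omega>"
  have "\<forall>\<^sub>F \<xi> in nhds x. g \<xi> t = f \<xi> t" "\<forall>\<^sub>F \<tau> in nhds t. g x \<tau> = f x \<tau>"
    using eventually_slices[OF assms(1) xt] assms(3) by (auto elim: eventually_mono)
  then show "((\<lambda>\<xi>. g \<xi> t) has_real_derivative gx x t) (at x)"
    "((\<lambda>\<tau>. g x \<tau>) has_real_derivative gt x t) (at t)"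
    using has_partialsD(1,2)[OF assms(2) xt] assms(4,5)[OF xt]
    by (simp_all add: DERIV_cong_ev)
qed

lemma Ck_on_imp_continuous: "Ck_on k \<Omega> f \<Longrightarrow> continuous_on \<Omega> (\<lambda>(x, t). f x t)"
  by (cases k) auto

lemma Ck_on_Suc_imp_has_partials: "Ck_on (Suc k) \<Omega> f \<Longrightarrow> has_partials \<Omega> f (dx f) (dt f)"
  by (fastforce simp: has_partials_def dx_def dt_def DERIV_deriv_iff_real_differentiable)

lemma Ck_on_cong:
  assumes "open \<Omega>"
  shows "Ck_on k \<Omega> f \<Longrightarrow> (\<And>x t. (x, t) \<in> \<Omega> \<Longrightarrow> g x t = f x t) \<Longrightarrow> Ck_on k \<Omega> g"
proof (induction k arbitrary: f g)
  case 0
  then show ?case by (auto elim!: continuous_on_eq)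
next
  case (Suc k)
  have c: "continuous_on \<Omega> (\<lambda>(x, t). g x t)"
    using Ck_on_imp_continuous[OF Suc.prems(1)] Suc.prems(2)
    by (auto elim!: continuous_on_eq)
  have p: "has_partials \<Omega> g (dx f) (dt f)"
    using has_partials_cong[OF assms Ck_on_Suc_imp_has_partials[OF Suc.prems(1)]] Suc.prems(2) by blast
  have "Ck_on k \<Omega> (dx g)" "Ck_on k \<Omega> (dt g)"
    using Suc.IH Suc.prems(1) has_partialsD(3,4)[OF p] by auto
  with c show ?case
    using has_partials_imp_differentiable[OF p] by simp
qed

text \<open>Replaces the \<open>deriv\<close>-based \<open>dx f\<close> and \<open>dt f\<close> by
  closed formulas agreeing with them on Omega, so that inductions on the order can work with
  explicit expressions.\<close>

lemma Ck_on_SucI: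
  assumes "open \<Omega>" "continuous_on \<Omega> (\<lambda>(x, t). f x t)" "has_partials \<Omega> f fx ft"
    and "Ck_on k \<Omega> fx" "Ck_on k \<Omega> ft"
  shows "Ck_on (Suc k) \<Omega> f"
proof -
  have "Ck_on k \<Omega> (dx f)" "Ck_on k \<Omega> (dt f)"
    using Ck_on_cong[OF assms(1)] assms(4,5) has_partialsD(3,4)[OF assms(3)] by auto
  then show ?thesis
    using assms(2) has_partials_imp_differentiable[OF assms(3)] by simp
qed

lemma Ck_on_SucD: "Ck_on (Suc k) \<Omega> f \<Longrightarrow> Ck_on k \<Omega> f"
proof (induction k arbitrary: f)
  case 0
  then show ?case by simp
next
  case (Suc k)
  note f = Suc.prems[unfolded Ck_on.simps(2)[of "Suc k"]]
  then have "Ck_on k \<Omega> (dx f)" "Ck_on k \<Omega> (dt f)"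
    by (auto intro: Suc.IH simp del: Ck_on.simps)
  with f show ?case
    unfolding Ck_on.simps(2)[of k] by blast
qed

lemma Ck_on_const: "open \<Omega> \<Longrightarrow> Ck_on k \<Omega> (\<lambda>x t. c)"
proof (induction k arbitrary: c)
  case (Suc k)
  show ?case
    by (rule Ck_on_SucI[OF Suc.prems, where fx = "\<lambda>x t. 0" and ft = "\<lambda>x t. 0"])
      (auto simp: has_partials_def Suc)
qed simp

lemma Ck_on_add:
  assumes "open \<Omega>"
  shows "Ck_on k \<Omega> f \<Longrightarrow> Ck_on k \<Omega> g \<Longrightarrow> Ck_on k \<Omega> (\<lambda>x t. f x t + g x t)"
proof (induction k arbitrary: f g)
  case 0
  then show ?case by (auto simp: case_prod_beta intro: continuous_on_add)
next
  case (Suc k)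
  have "has_partials \<Omega> (\<lambda>x t. f x t + g x t) (\<lambda>x t. dx f x t + dx g x t) (\<lambda>x t. dt f x t + dt g x t)"
    using Suc.prems[THEN Ck_on_Suc_imp_has_partials]
    by (auto simp: has_partials_def intro!: derivative_intros)
  moreover have "continuous_on \<Omega> (\<lambda>(x, t). f x t + g x t)"
    using Suc.prems[THEN Ck_on_imp_continuous] by (auto simp: case_prod_beta intro: continuous_on_add)
  ultimately show ?case
    using Suc by (intro Ck_on_SucI[OF assms]) auto
qed

lemma Ck_on_mult:
  assumes "open \<Omega>"
  shows "Ck_on k \<Omega> f \<Longrightarrow> Ck_on k \<Omega> g \<Longrightarrow> Ck_on k \<Omega> (\<lambda>x t. f x t * g x t)"
proof (induction k arbitrary: f g)
  case 0
  then show ?case by (auto simp: case_prod_beta intro: continuous_on_mult)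
next
  case (Suc k)
  have "has_partials \<Omega> (\<lambda>x t. f x t * g x t)
      (\<lambda>x t. dx f x t * g x t + f x t * dx g x t) (\<lambda>x t. dt f x t * g x t + f x t * dt g x t)"
    using Suc.prems[THEN Ck_on_Suc_imp_has_partials]
    by (auto simp: has_partials_def intro!: derivative_eq_intros)
  moreover have "continuous_on \<Omega> (\<lambda>(x, t). f x t * g x t)"
    using Suc.prems[THEN Ck_on_imp_continuous] by (auto simp: case_prod_beta intro: continuous_on_mult)
  \<comment> \<open>The product rule involves the undifferentiated factors too, and the induction
    hypothesis wants them at order \<open>k\<close>.\<close>
  moreover have "Ck_on k \<Omega> f" "Ck_on k \<Omega> g"
    using Suc.prems by (blast intro: Ck_on_SucD)+
  then have "Ck_on k \<Omega> (\<lambda>x t. dx f x t * g x t + f x t * dx g x t)"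
    "Ck_on k \<Omega> (\<lambda>x t. dt f x t * g x t + f x t * dt g x t)"
    using Suc by (simp_all add: Ck_on_add[OF assms])
  ultimately show ?case
    by (intro Ck_on_SucI[OF assms])
qed

section \<open>Derivatives of the exponential along an inverse branch\<close>

text \<open>Implicit differentiation of x(Y(x,t),t) = x in both variables, followed by the chain
  rule for the exponential. Writing the t-partial as \<open>E' x t / \<rho>^2\<close> records the
  travelling-wave property.\<close>

lemma e_hat_branch_partials:
  assumes "\<rho> > 0" "smooth_inverse_branch \<rho> y0 \<Omega> Y"
  defines "E \<equiv> \<lambda>x t. e_hat \<rho> y0 (Y x t) t"
  defines "E' \<equiv> \<lambda>x t. - (sqrt 3 * \<rho>) * E x t * q_hat \<rho> y0 (Y x t) t"
  shows "has_partials \<Omega> E E' (\<lambda>x t. E' x t / \<rho>^2)"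
  unfolding has_partials_def
proof (intro allI impI)
  fix x t assume xt: "(x, t) \<in> \<Omega>"
  have op: "open \<Omega>" and inv: "\<And>x t. (x, t) \<in> \<Omega> \<Longrightarrow> x_map \<rho> y0 (Y x t) t = x"
    and nz: "1 - 4 * E x t + (E x t)^2 \<noteq> 0" and C1: "Ck_on 1 \<Omega> Y"
    using assms(2) xt unfolding smooth_inverse_branch_def smooth_on_def E_def by auto
  have pos: "E \<xi> \<tau> > 0" for \<xi> \<tau> by (simp add: E_def e_hat_def)
  have ne1: "1 + E \<xi> \<tau> \<noteq> 0" for \<xi> \<tau> using pos[of \<xi> \<tau>] by linarith
  have q: "q_hat \<rho> y0 (Y x t) t = (1 + E x t)^2 / (1 - 4 * E x t + (E x t)^2)"
    by (simp add: q_hat_def E_def power2_eq_square algebra_simps)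
  have x_map_E: "x_map \<rho> y0 (Y \<xi> \<tau>) \<tau> = Y \<xi> \<tau> + 2 * sqrt 3 / \<rho> * (E \<xi> \<tau> / (1 + E \<xi> \<tau>))" for \<xi> \<tau>
    by (simp add: x_map_def E_def)
  note pY = has_partialsD(1,2)[OF Ck_on_Suc_imp_has_partials xt, of 0 Y, simplified One_nat_def[symmetric], OF C1]
  have dG: "((\<lambda>z. z / (1 + z)) has_real_derivative 1 / (1 + z)^2) (at z)" if "1 + z \<noteq> 0" for z :: real
    using that by (auto intro!: derivative_eq_intros simp: power2_eq_square)
  \<comment> \<open>These are the partials of the phase Y + t/rho^2 + y0 in the exponent. With
    1/rho^2 absorbed into \<open>b\<close>, both differentiated identities become the same linear
    equation, with right-hand side 1 for \<open>a\<close> and 1/rho^2 for \<open>b\<close>.\<close>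
  define a b where "a = dx Y x t" and "b = dt Y x t + 1 / \<rho>^2"
  \<comment> \<open>Since sqrt 3 * sqrt 3 = 3 and (1 + E)^2 - 6E = 1 - 4E + E^2, the coefficient of
    \<open>s\<close> is the reciprocal of q; the branch condition makes it nonzero.\<close>
  have key: "s = (1 + E x t)^2 / (1 - 4 * E x t + (E x t)^2) * r"
    if "s + 2 * sqrt 3 / \<rho> * (- (sqrt 3 * \<rho>) * E x t * s / (1 + E x t)^2) = r" for s r
  proof -
    have "2 * sqrt 3 / \<rho> * (- (sqrt 3 * \<rho>) * E x t * s / (1 + E x t)^2)
        = - 2 * (sqrt 3 * sqrt 3) * E x t * s / (1 + E x t)^2"
      using assms(1) by simp
    also have "\<dots> = - (6 * E x t * s / (1 + E x t)^2)"
      unfolding real_sqrt_mult_self by simp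
    finally have "s - 6 * E x t * s / (1 + E x t)^2 = r"
      using that by linarith
    then have "s * (1 - 4 * E x t + (E x t)^2) = r * (1 + E x t)^2"
      using ne1[of x t] by (simp add: divide_simps power2_eq_square) algebra
    then show ?thesis using nz by (simp add: eq_divide_eq mult.commute)
  qed
  have dE: "((\<lambda>\<xi>. E \<xi> t) has_real_derivative - (sqrt 3 * \<rho>) * E x t * a) (at x)"
    unfolding E_def e_hat_def a_def
    by (rule DERIV_cong[OF DERIV_fun_exp[OF DERIV_cmult[OF DERIV_add[OF DERIV_add[OF pY(1) DERIV_const] DERIV_const]]]])
      (simp add: algebra_simps)
  have "((\<lambda>\<xi>. x_map \<rho> y0 (Y \<xi> t) t) has_real_derivative
      a + 2 * sqrt 3 / \<rho> * (- (sqrt 3 * \<rho>) * E x t * a / (1 + E x t)^2)) (at x)"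
    unfolding x_map_E a_def
    by (rule DERIV_cong[OF DERIV_add[OF pY(1) DERIV_cmult[OF DERIV_chain2[OF dG[OF ne1] dE[unfolded a_def]]]]]) simp
  moreover have "((\<lambda>\<xi>. x_map \<rho> y0 (Y \<xi> t) t) has_real_derivative 1) (at x)"
  proof -
    \<comment> \<open>The inverse identity holds on a whole neighbourhood in the slice, so it may be
      differentiated there.\<close>
    have "\<forall>\<^sub>F \<xi> in nhds x. x_map \<rho> y0 (Y \<xi> t) t = \<xi>"
      using eventually_slices(1)[OF op xt] inv by (auto elim: eventually_mono)
    then show ?thesis by (simp add: DERIV_cong_ev)
  qed
  ultimately have "a + 2 * sqrt 3 / \<rho> * (- (sqrt 3 * \<rho>) * E x t * a / (1 + E x t)^2) = 1"
    by (rule DERIV_unique)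
  then have a: "a = q_hat \<rho> y0 (Y x t) t"
    using key[of a 1] q by simp
  have dEt: "((\<lambda>\<tau>. E x \<tau>) has_real_derivative - (sqrt 3 * \<rho>) * E x t * b) (at t)"
    unfolding E_def e_hat_def b_def
    by (rule DERIV_cong[OF DERIV_fun_exp[OF DERIV_cmult[OF DERIV_add[OF DERIV_add[OF pY(2) DERIV_cdivide[OF DERIV_ident]] DERIV_const]]]])
      (simp add: algebra_simps)
  have "((\<lambda>\<tau>. x_map \<rho> y0 (Y x \<tau>) \<tau>) has_real_derivative
      (b - 1 / \<rho>^2) + 2 * sqrt 3 / \<rho> * (- (sqrt 3 * \<rho>) * E x t * b / (1 + E x t)^2)) (at t)"
    unfolding x_map_E b_def
    by (rule DERIV_cong[OF DERIV_add[OF pY(2) DERIV_cmult[OF DERIV_chain2[OF dG[OF ne1] dEt[unfolded b_def]]]]]) simp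
  moreover have "((\<lambda>\<tau>. x_map \<rho> y0 (Y x \<tau>) \<tau>) has_real_derivative 0) (at t)"
  proof -
    have "\<forall>\<^sub>F \<tau> in nhds t. x_map \<rho> y0 (Y x \<tau>) \<tau> = x"
      using eventually_slices(2)[OF op xt] inv by (auto elim: eventually_mono)
    then show ?thesis by (simp add: DERIV_cong_ev)
  qed
  ultimately have "(b - 1 / \<rho>^2) + 2 * sqrt 3 / \<rho> * (- (sqrt 3 * \<rho>) * E x t * b / (1 + E x t)^2) = 0"
    by (rule DERIV_unique)
  then have b: "b = q_hat \<rho> y0 (Y x t) t / \<rho>^2"
    using key[of b "1 / \<rho>^2"] q by simp
  show "((\<lambda>\<xi>. E \<xi> t) has_real_derivative E' x t) (at x) \<and>
      ((\<lambda>\<tau>. E x \<tau>) has_real_derivative E' x t / \<rho>^2) (at t)"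
    using dE dEt unfolding a b by (simp add: E'_def)
qed

section \<open>Profiles of a travelling wave and bootstrapping of regularity\<close>

text \<open>By the chain rule, the proportionality between the t-partial and the x-partial passes
  from \<open>E\<close> to every differentiable function of \<open>E\<close>.\<close>

lemma has_partials_compose:
  assumes "has_partials \<Omega> E E' (\<lambda>x t. E' x t / c)"
    and "\<And>x t. (x, t) \<in> \<Omega> \<Longrightarrow> (F has_real_derivative F' (E x t)) (at (E x t))"
    and "\<And>x t. (x, t) \<in> \<Omega> \<Longrightarrow> fx x t = F' (E x t) * E' x t"
  shows "has_partials \<Omega> (\<lambda>x t. F (E x t)) fx (\<lambda>x t. fx x t / c)"
  unfolding has_partials_def
proof (intro allI impI conjI)
  fix x t assume xt: "(x, t) \<in> \<Omega>"
  show "((\<lambda>\<xi>. F (E \<xi> t)) has_real_derivative fx x t) (at x)"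
    using DERIV_chain2[OF assms(2)[OF xt] has_partialsD(1)[OF assms(1) xt]] assms(3)[OF xt] by simp
  show "((\<lambda>\<tau>. F (E x \<tau>)) has_real_derivative fx x t / c) (at t)"
    using DERIV_chain2[OF assms(2)[OF xt] has_partialsD(2)[OF assms(1) xt]] assms(3)[OF xt] by simp
qed

text \<open>All first partials are polynomials in \<open>q\<close> and \<open>w\<close>, up to
  constant factors, so each order of regularity of the three functions yields the next; continuity
  starts the induction.\<close>

lemma Ck_on_polynomial_system:
  assumes op: "open \<Omega>"
    and cont: "continuous_on \<Omega> (\<lambda>(x, t). u x t)" "continuous_on \<Omega> (\<lambda>(x, t). q x t)"
      "continuous_on \<Omega> (\<lambda>(x, t). w x t)"
    and u: "has_partials \<Omega> u w (\<lambda>x t. w x t / c)"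
    and q: "has_partials \<Omega> q (\<lambda>x t. - c * w x t * (q x t)^2) (\<lambda>x t. - c * w x t * (q x t)^2 / c)"
    and w: "has_partials \<Omega> w (\<lambda>x t. 1 - (q x t)^3) (\<lambda>x t. (1 - (q x t)^3) / c)"
  shows "Ck_on k \<Omega> u \<and> Ck_on k \<Omega> q \<and> Ck_on k \<Omega> w"
proof (induction k)
  case 0
  then show ?case using cont by simp
next
  case (Suc k)
  note mult = Ck_on_mult[OF op] and const = Ck_on_const[OF op]
  have scale: "Ck_on k \<Omega> (\<lambda>x t. f x t / c)" if "Ck_on k \<Omega> f" for f
    using mult[OF that const[of k "1 / c"]] by simp
  have ux: "Ck_on k \<Omega> w"
    using Suc by simp
  have qx: "Ck_on k \<Omega> (\<lambda>x t. - c * w x t * (q x t)^2)"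
    using mult[OF mult[OF const[of k "- c"]]] mult Suc by (auto simp: power2_eq_square)
  \<comment> \<open>The cubic is spelled out as a sum of products to match the closure rules for
    constants, sums and products.\<close>
  have "Ck_on k \<Omega> (\<lambda>x t. 1 + (- 1) * (q x t * (q x t * q x t)))"
    using Suc by (intro Ck_on_add[OF op] mult const) auto
  then have wx: "Ck_on k \<Omega> (\<lambda>x t. 1 - (q x t)^3)"
    by (simp add: power3_eq_cube mult.assoc)
  show ?case
    using Ck_on_SucI[OF op cont(1) u ux scale[OF ux]] Ck_on_SucI[OF op cont(2) q qx scale[OF qx]]
      Ck_on_SucI[OF op cont(3) w wx scale[OF wx]] by (intro conjI)
qed

section \<open>The soliton on a branch: smoothness and verification of the equations\<close>

theorem mainTheorem4:
  fixes \<rho> y0 :: real and \<Omega> :: "(real \<times> real) set" and Y u q :: "real \<Rightarrow> real \<Rightarrow> real"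
  assumes "\<rho> > 0"
    and "smooth_inverse_branch \<rho> y0 \<Omega> Y"
    and "\<And>x t. (x, t) \<in> \<Omega> \<Longrightarrow> u x t = u_hat \<rho> y0 (Y x t) t"
    and "\<And>x t. (x, t) \<in> \<Omega> \<Longrightarrow> q x t = q_hat \<rho> y0 (Y x t) t"
  shows "smooth_on \<Omega> u \<and> smooth_on \<Omega> q \<and>
    (\<forall>(x, t) \<in> \<Omega>.
       dt q x t = - dx (\<lambda>x t. u x t * q x t) x t \<and>
       dx (dx u) x t = 1 - (q x t)^3 \<and>
       dx (dx (dt u)) x t - 3 * dx u x t + 3 * dx u x t * dx (dx u) x t
         + u x t * dx (dx (dx u)) x t = 0)"
proof -
  define E where "E = (\<lambda>x t. e_hat \<rho> y0 (Y x t) t)"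
  define D where "D = (\<lambda>z::real. 1 - 4 * z + z^2)"
  define U where "U = (\<lambda>z. - (6 / \<rho>^2) * (z / (1 + z)^2))"
  define Q where "Q = (\<lambda>z. (1 + z)^2 / D z)"
  \<comment> \<open>\<open>W\<close> is the simplified product of U'(z) and the factor -sqrt 3 * rho
    * z * Q(z) by which \<open>E\<close> changes in x, so \<open>w\<close> will be u_x.\<close>
  define W where "W = (\<lambda>z. 6 * sqrt 3 / \<rho> * (z * (1 - z) / ((1 + z) * D z)))"
  define E' where "E' = (\<lambda>x t. - (sqrt 3 * \<rho>) * E x t * Q (E x t))"
  define w where "w = (\<lambda>x t. W (E x t))"
  have op: "open \<Omega>" and C0: "Ck_on 0 \<Omega> Y"
    using assms(2) unfolding smooth_inverse_branch_def smooth_on_def by blast+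
  have nz: "D (E x t) \<noteq> 0" if "(x, t) \<in> \<Omega>" for x t
    using assms(2) that unfolding smooth_inverse_branch_def E_def D_def by auto
  have pos: "E x t > 0" for x t by (simp add: E_def e_hat_def)
  have ne1: "1 + E x t \<noteq> 0" for x t using pos[of x t] by linarith
  have uU: "u x t = U (E x t)" if "(x, t) \<in> \<Omega>" for x t
    using assms(3)[OF that] by (simp add: u_hat_def U_def E_def)
  have qhat: "q_hat \<rho> y0 (Y x t) t = Q (E x t)" for x t
    by (simp add: q_hat_def Q_def D_def E_def power2_eq_square algebra_simps)
  have qQ: "q x t = Q (E x t)" if "(x, t) \<in> \<Omega>" for x t
    using assms(4)[OF that] qhat by simp
  have E: "has_partials \<Omega> E E' (\<lambda>x t. E' x t / \<rho>^2)"
    using e_hat_branch_partials[OF assms(1,2)] unfolding qhat E'_def by (simp only: E_def)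
  have dU: "(U has_real_derivative - (6 / \<rho>^2) * ((1 - z) / (1 + z)^3)) (at z)" if "z > 0" for z
    unfolding U_def using that assms(1)
    by (auto intro!: derivative_eq_intros simp: divide_simps add_nonneg_eq_0_iff) (simp add: algebra_simps power_numeral_reduce)
  have dQ: "(Q has_real_derivative 6 * (1 - z) * (1 + z) / (D z)^2) (at z)" if "D z \<noteq> 0" for z
    using that unfolding Q_def D_def
    by (auto intro!: derivative_eq_intros simp: divide_simps) (simp add: algebra_simps power_numeral_reduce)
  have dW: "(W has_real_derivative
      6 * sqrt 3 / \<rho> * (((1 - 2 * z) * ((1 + z) * D z) - z * (1 - z) * (D z + (1 + z) * (2 * z - 4)))
         / ((1 + z) * D z)^2)) (at z)"
    if "z > 0" "D z \<noteq> 0" for z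
    using that assms(1) unfolding W_def D_def
    by (auto intro!: derivative_eq_intros simp: divide_simps power2_eq_square) (simp add: algebra_simps)
  have r0: "\<rho> \<noteq> 0" using assms(1) by simp
  have "has_partials \<Omega> (\<lambda>x t. U (E x t)) w (\<lambda>x t. w x t / \<rho>^2)"
  proof (rule has_partials_compose[OF E dU[OF pos]])
    fix x t assume xt: "(x, t) \<in> \<Omega>"
    show "w x t = - (6 / \<rho>^2) * ((1 - E x t) / (1 + E x t)^3) * E' x t"
      unfolding w_def W_def E'_def Q_def using nz[OF xt] ne1[of x t] r0
      by (simp add: divide_simps power_numeral_reduce)
  qed
  then have pu: "has_partials \<Omega> u w (\<lambda>x t. w x t / \<rho>^2)"
    by (rule has_partials_cong[OF op]) (simp_all add: uU)
  \<comment> \<open>The shape of q_x comes from rho^2 u = 1/q - 1, whose x-derivative is rho^2 w = -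
    q_x / q^2; here it is checked directly on the profiles.\<close>
  have "has_partials \<Omega> (\<lambda>x t. Q (E x t)) (\<lambda>x t. - (\<rho>^2) * w x t * (Q (E x t))^2)
      (\<lambda>x t. - (\<rho>^2) * w x t * (Q (E x t))^2 / \<rho>^2)"
  proof (rule has_partials_compose[OF E dQ[OF nz]])
    fix x t assume xt: "(x, t) \<in> \<Omega>"
    show "- (\<rho>^2) * w x t * (Q (E x t))^2 = 6 * (1 - E x t) * (1 + E x t) / (D (E x t))^2 * E' x t"
      unfolding w_def W_def E'_def Q_def using nz[OF xt] ne1[of x t] r0
      by (simp add: divide_simps power_numeral_reduce)
  qed
  then have pq: "has_partials \<Omega> q (\<lambda>x t. - (\<rho>^2) * w x t * (q x t)^2) (\<lambda>x t. - (\<rho>^2) * w x t * (q x t)^2 / \<rho>^2)"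
    by (rule has_partials_cong[OF op]) (simp_all add: qQ)
  have "has_partials \<Omega> w (\<lambda>x t. 1 - (Q (E x t))^3) (\<lambda>x t. (1 - (Q (E x t))^3) / \<rho>^2)"
    unfolding w_def
  proof (rule has_partials_compose[OF E dW[OF pos nz]])
    fix x t assume xt: "(x, t) \<in> \<Omega>"
    define z d where "z = E x t" and "d = D z"
    have d: "d \<noteq> 0" "1 + z \<noteq> 0" using nz[OF xt] ne1[of x t] by (auto simp: d_def z_def)
    \<comment> \<open>The algebraic core of u_xx = 1 - q^3. The last factor is the quotient-rule
      numerator from \<open>dW\<close>, where 2z - 4 is the derivative of \<open>D\<close>, and -18
      is the product of 6 sqrt 3 / rho and - sqrt 3 * rho.\<close>
    have "d^3 - (1 + z)^6 = - 18 * z * ((1 - 2 * z) * ((1 + z) * d) - z * (1 - z) * (d + (1 + z) * (2 * z - 4)))"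
      unfolding d_def D_def by algebra
    then have "1 - ((1 + z)^2 / d)^3 = - 18 * z *
       ((1 - 2 * z) * ((1 + z) * d) - z * (1 - z) * (d + (1 + z) * (2 * z - 4))) / d^3"
      using d by (simp add: field_simps)
    also have "\<dots> = 6 * sqrt 3 / \<rho> * (((1 - 2 * z) * ((1 + z) * d) - z * (1 - z) * (d + (1 + z) * (2 * z - 4)))
         / ((1 + z) * d)^2) * (- (sqrt 3 * \<rho>) * z * ((1 + z)^2 / d))"
    proof -
      \<comment> \<open>A variable \<open>X\<close> in place of the long numerator keeps the
        simplifier from expanding it.\<close>
      have "- 18 * z * X / d^3 = 6 * sqrt 3 / \<rho> * (X / ((1 + z) * d)^2) * (- (sqrt 3 * \<rho>) * z * ((1 + z)^2 / d))" for X
        using d r0 by (simp add: divide_simps power_numeral_reduce)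
      then show ?thesis .
    qed
    finally show "1 - (Q (E x t))^3 = 6 * sqrt 3 / \<rho> * (((1 - 2 * E x t) * ((1 + E x t) * D (E x t))
        - E x t * (1 - E x t) * (D (E x t) + (1 + E x t) * (2 * E x t - 4)))
         / ((1 + E x t) * D (E x t))^2) * E' x t"
      unfolding Q_def E'_def z_def d_def .
  qed
  then have pw: "has_partials \<Omega> w (\<lambda>x t. 1 - (q x t)^3) (\<lambda>x t. (1 - (q x t)^3) / \<rho>^2)"
    by (rule has_partials_cong[OF op]) (simp_all add: qQ)
  \<comment> \<open>Partial derivatives along slices do not give joint continuity, so the start of
    the bootstrapping is obtained separately: \<open>E\<close> is jointly continuous because
    \<open>Y\<close> is, and u, q, w are continuous functions of \<open>E\<close>.\<close>
  have cE: "continuous_on \<Omega> (\<lambda>p. E (fst p) (snd p))"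
    using C0 r0 unfolding E_def e_hat_def by (auto simp: case_prod_beta intro!: continuous_intros)
  have cF: "continuous_on \<Omega> (\<lambda>(x, t). f x t)"
    if "\<And>x t. (x, t) \<in> \<Omega> \<Longrightarrow> f x t = F (E x t)"
      "\<And>x t. (x, t) \<in> \<Omega> \<Longrightarrow> isCont F (E x t)" for f F
  proof -
    have "continuous_on \<Omega> (\<lambda>p. F (E (fst p) (snd p)))"
      by (rule continuous_on_compose2[OF _ cE subset_refl])
        (auto intro!: continuous_at_imp_continuous_on that(2))
    then show ?thesis by (rule continuous_on_eq) (auto simp: that(1))
  qed
  have "Ck_on k \<Omega> u \<and> Ck_on k \<Omega> q \<and> Ck_on k \<Omega> w" for k
  proof (rule Ck_on_polynomial_system[OF op _ _ _ pu pq pw])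
    show "continuous_on \<Omega> (\<lambda>(x, t). u x t)"
      by (rule cF[of u U]) (auto simp: uU intro: DERIV_isCont[OF dU[OF pos]])
    show "continuous_on \<Omega> (\<lambda>(x, t). q x t)"
      by (rule cF[of q Q]) (auto simp: qQ intro: DERIV_isCont[OF dQ[OF nz]])
    show "continuous_on \<Omega> (\<lambda>(x, t). w x t)"
      by (rule cF[of w W]) (auto simp: w_def intro: DERIV_isCont[OF dW[OF pos nz]])
  qed
  then have smooth: "smooth_on \<Omega> u" "smooth_on \<Omega> q"
    unfolding smooth_on_def by auto
  \<comment> \<open>In the product u q the factors (1 + z)^2 cancel, leaving -6z / (rho^2 D); and D
    - (1 + z)^2 = -6z.\<close>
  have alg: "\<rho>^2 * u x t * q x t = 1 - q x t" if "(x, t) \<in> \<Omega>" for x t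
  proof -
    have "1 - Q (E x t) = - 6 * E x t / D (E x t)"
      unfolding Q_def using nz[OF that] by (simp add: field_simps) (simp add: D_def power2_eq_square algebra_simps)
    then show ?thesis
      unfolding uU[OF that] qQ[OF that] U_def using nz[OF that] ne1[of x t] r0 by (simp add: Q_def)
  qed
  have puxx: "has_partials \<Omega> (dx u) (\<lambda>x t. 1 - (q x t)^3) (\<lambda>x t. (1 - (q x t)^3) / \<rho>^2)"
    by (rule has_partials_cong[OF op pw]) (simp_all add: has_partialsD[OF pu])
  define qx where "qx = (\<lambda>x t. - (\<rho>^2) * w x t * (q x t)^2)"
  have "has_partials \<Omega> (\<lambda>x t. 1 - (q x t)^3) (\<lambda>x t. - 3 * (q x t)^2 * qx x t) (\<lambda>x t. - 3 * (q x t)^2 * (qx x t / \<rho>^2))"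
    using pq by (auto simp: has_partials_def qx_def intro!: derivative_eq_intros)
  then have puxxx: "has_partials \<Omega> (dx (dx u)) (\<lambda>x t. - 3 * (q x t)^2 * qx x t) (\<lambda>x t. - 3 * (q x t)^2 * (qx x t / \<rho>^2))"
    by (rule has_partials_cong[OF op]) (simp_all add: has_partialsD[OF puxx])
  have scale: "has_partials \<Omega> (\<lambda>x t. f x t / c) (\<lambda>x t. fx x t / c) (\<lambda>x t. ft x t / c)"
    if "has_partials \<Omega> f fx ft" for f fx ft c
    using that by (auto simp: has_partials_def intro!: DERIV_cdivide)
  \<comment> \<open>Here u_t = w / rho^2 on Omega, so the mixed derivative u_txx will be u_xxx /
    rho^2.\<close>
  have put: "has_partials \<Omega> (dt u) (\<lambda>x t. (1 - (q x t)^3) / \<rho>^2) (\<lambda>x t. (1 - (q x t)^3) / \<rho>^2 / \<rho>^2)"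
    by (rule has_partials_cong[OF op scale[OF pw, of "\<rho>^2"]]) (simp_all add: has_partialsD[OF pu])
  have putx: "has_partials \<Omega> (dx (dt u)) (\<lambda>x t. - 3 * (q x t)^2 * qx x t / \<rho>^2) (\<lambda>x t. - 3 * (q x t)^2 * (qx x t / \<rho>^2) / \<rho>^2)"
    by (rule has_partials_cong[OF op scale[OF puxxx, of "\<rho>^2"]]) (simp_all add: has_partialsD[OF put] has_partialsD[OF puxx])
  \<comment> \<open>As u q = (1 - q) / rho^2, its x-derivative is - q_x / rho^2 = - q_t, which is
    the conservation law.\<close>
  have uq: "has_partials \<Omega> (\<lambda>x t. u x t * q x t) (\<lambda>x t. - qx x t / \<rho>^2) (\<lambda>x t. - qx x t / \<rho>^2 / \<rho>^2)"
  proof (rule has_partials_cong[OF op scale[of _ _ _ "\<rho>^2"]])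
    show "has_partials \<Omega> (\<lambda>x t. 1 - q x t) (\<lambda>x t. - qx x t) (\<lambda>x t. - qx x t / \<rho>^2)"
      using pq by (auto simp: has_partials_def qx_def intro!: derivative_eq_intros)
    show "u x t * q x t = (1 - q x t) / \<rho>^2" if "(x, t) \<in> \<Omega>" for x t
      using alg[OF that] r0 by (simp add: field_simps)
  qed simp_all
  have "dt q x t = - dx (\<lambda>x t. u x t * q x t) x t \<and>
       dx (dx u) x t = 1 - (q x t)^3 \<and>
       dx (dx (dt u)) x t - 3 * dx u x t + 3 * dx u x t * dx (dx u) x t
         + u x t * dx (dx (dx u)) x t = 0" if xt: "(x, t) \<in> \<Omega>" for x t
  proof (intro conjI)
    show "dt q x t = - dx (\<lambda>x t. u x t * q x t) x t"
      by (simp add: has_partialsD(3)[OF uq xt] has_partialsD(4)[OF pq xt] qx_def)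
    show "dx (dx u) x t = 1 - (q x t)^3"
      by (rule has_partialsD(3)[OF puxx xt])
    \<comment> \<open>With u_txx = 3 w q^4 and u u_xxx = 3 w q^3 (1 - q), the latter by
      \<open>alg\<close>, these two terms add up to 3 w q^3; this cancels - 3 w + 3 w (1 -
      q^3).\<close>
    have "- 3 * (q x t)^2 * qx x t / \<rho>^2 = 3 * w x t * (q x t)^4"
      using r0 by (simp add: qx_def power_numeral_reduce)
    moreover have "u x t * (- 3 * (q x t)^2 * qx x t) = 3 * w x t * (q x t)^3 * (\<rho>^2 * u x t * q x t)"
      by (simp add: qx_def power_numeral_reduce)
    ultimately show "dx (dx (dt u)) x t - 3 * dx u x t + 3 * dx u x t * dx (dx u) x t
         + u x t * dx (dx (dx u)) x t = 0"
      unfolding has_partialsD(3)[OF putx xt] has_partialsD(3)[OF pu xt] has_partialsD(3)[OF puxx xt]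
        has_partialsD(3)[OF puxxx xt] alg[OF xt]
      by (simp only:) (simp add: algebra_simps power_numeral_reduce)
  qed
  then show ?thesis using smooth by auto
qed

end
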